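(* For all positive integers $n$, we have $$\binom{2n}{n}\, n! = \sum_{r=0}^{2n} \binom{2n}{r} (-1)^r\, y(r)\,y(2n-r).$$
   Context: For a nonnegative integer $m$, $y(m)$ denotes the number of involutions of an $m$-element set, i.e. the number of permutations $v$ of the set with $v\circ v=\mathrm{id}$ (the identity is included; $y(0)=1$). *)

theory Defs
  imports Complex_Main "HOL-Combinatorics.Permutations"
begin

definition involutions :: "'a set \<Rightarrow> ('a \<Rightarrow> 'a) set" where
  "involutions S = {v. v permutes S \<and> v \<circ> v = id}"

(* v permutes S fixes every point outside S, so v \<circ> v = id only constrains v on S,
   and permutations of S are counted without repetition. *)
definition num_involutions :: "nat \<Rightarrow> nat" where
  "num_involutions m = card (involutions {..<m})"

end

theory Submission
  imports Defs "HOL-Computational_Algebra.Formal_Power_Series"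
begin

unbundle fps_syntax

text \<open>
  Let \<open>Y\<close> be the exponential generating function of the numbers \<open>y m\<close> of involutions. An
  involution either fixes a given point or swaps it with one of the \<open>m\<close> others, so
  \<open>y (m + 1) = y m + m * y (m - 1)\<close>; equivalently \<open>Y' = (1 + X) * Y\<close>, that is,
  \<open>Y = exp (X + X^2 / 2)\<close>. The alternating convolution on the right-hand side of the theorem is
  \<open>(2 n)!\<close> times the coefficient of \<open>X ^ (2 n)\<close> in \<open>Y (- X) * Y (X)\<close>. The odd parts of the two
  exponents cancel, so this product is \<open>exp (X^2)\<close>, with coefficient \<open>1 / n!\<close>, and
  \<open>(2 n)! / n!\<close> is the left-hand side.

  The exponentials remain implicit: the product \<open>P\<close> is determined by \<open>P' = 2 * X * P\<close> and its
  constant term, and this differential equation follows from the one for \<open>Y\<close>.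
\<close>

lemma involution_apply: "v \<in> involutions S \<Longrightarrow> v (v x) = x"
  by (auto simp: involutions_def fun_eq_iff)

lemma involution_outside: "v \<in> involutions S \<Longrightarrow> x \<notin> S \<Longrightarrow> v x = x"
  by (auto simp: involutions_def permutes_def)

text \<open>
  Bijectivity is automatic for a self-inverse map, so only the support has to be checked.
\<close>

lemma involutionsI:
  assumes "\<And>x. v (v x) = x" and "\<And>x. x \<notin> S \<Longrightarrow> v x = x"
  shows "v \<in> involutions S"
proof -
  have "\<exists>!x. v x = y" for y using assms(1) by metis
  with assms show ?thesis by (simp add: involutions_def permutes_def fun_eq_iff)
qed

lemma involutions_empty: "involutions {} = {id}"
  by (auto simp: involutions_def)

lemma finite_involutions: "finite S \<Longrightarrow> finite (involutions S)"
  by (rule finite_subset[OF _ finite_permutations]) (auto simp: involutions_def)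

text \<open>
  Composing with the transposition of \<open>x\<close> and \<open>a\<close> is its own inverse. It exchanges fixing both
  points with swapping them, and leaves the action on all other points unchanged.
\<close>

lemma bij_betw_involutions_swapping:
  assumes "x \<notin> S" "a \<in> S"
  shows "bij_betw (\<lambda>v. transpose x a \<circ> v) (involutions (S - {a}))
           {v \<in> involutions (insert x S). v x = a}"
proof (rule bij_betw_byWitness[where f' = "\<lambda>v. transpose x a \<circ> v"])
  have "x \<noteq> a" using assms by auto
  show "(\<lambda>v. transpose x a \<circ> v) ` involutions (S - {a}) \<subseteq>
          {v \<in> involutions (insert x S). v x = a}"
  proof clarify
    fix v assume v: "v \<in> involutions (S - {a})"
    have fixed: "v x = x" "v a = a"
      using v assms by (auto intro: involution_outside)
    have avoid: "v y = x \<longleftrightarrow> y = x" "v y = a \<longleftrightarrow> y = a" for y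
      using fixed involution_apply[OF v] by metis+
    have "transpose x a \<circ> v \<in> involutions (insert x S)"
    proof (rule involutionsI)
      show "(transpose x a \<circ> v) ((transpose x a \<circ> v) y) = y" for y
        using fixed avoid[of y] involution_apply[OF v, of y]
        by (auto simp: transpose_def)
      show "(transpose x a \<circ> v) y = y" if "y \<notin> insert x S" for y
        using that assms involution_outside[OF v, of y] by (auto simp: transpose_def)
    qed
    then show "transpose x a \<circ> v \<in> involutions (insert x S) \<and> (transpose x a \<circ> v) x = a"
      using fixed by simp
  qed
  show "(\<lambda>v. transpose x a \<circ> v) ` {v \<in> involutions (insert x S). v x = a} \<subseteq>
          involutions (S - {a})"
  proof clarify
    fix v assume v: "v \<in> involutions (insert x S)" and a: "a = v x"
    have va: "v a = x" using a involution_apply[OF v] by simp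
    have avoid: "v y = x \<longleftrightarrow> y = a" "v y = a \<longleftrightarrow> y = x" for y
      using a va involution_apply[OF v] by metis+
    have "transpose x a \<circ> v \<in> involutions (S - {a})"
    proof (rule involutionsI)
      show "(transpose x a \<circ> v) ((transpose x a \<circ> v) y) = y" for y
        using a va avoid[of y] involution_apply[OF v, of y] by (auto simp: transpose_def)
      show "(transpose x a \<circ> v) y = y" if "y \<notin> S - {a}" for y
        using that a[symmetric] va avoid[of y] involution_outside[OF v, of y]
        by (auto simp: transpose_def)
    qed
    then show "transpose x (v x) \<circ> v \<in> involutions (S - {v x})"
      by (simp only: a)
  qed
qed (auto simp: fun_eq_iff)

lemma card_involutions_insert:
  assumes "finite S" "x \<notin> S"
  shows "card (involutions (insert x S)) =
           card (involutions S) + (\<Sum>a\<in>S. card (involutions (S - {a})))"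
proof -
  let ?I = "involutions (insert x S)"
  let ?F = "\<lambda>a. {v \<in> ?I. v x = a}"
  have fixing: "?F x = involutions S"
  proof (intro equalityI subsetI)
    fix v assume "v \<in> ?F x"
    then show "v \<in> involutions S"
      by (auto intro!: involutionsI dest: involution_apply) (metis insertE involution_outside)
  next
    fix v assume "v \<in> involutions S"
    then show "v \<in> ?F x"
      using assms by (auto intro!: involutionsI dest: involution_apply involution_outside)
  qed
  have "v x \<in> insert x S" if "v \<in> ?I" for v
    using that by (auto simp: involutions_def permutes_in_image simp del: insert_iff)
  then have "?I = (\<Union>a\<in>insert x S. ?F a)" by auto
  then have "card ?I = card (\<Union>a\<in>insert x S. ?F a)" by simp
  also have "\<dots> = (\<Sum>a\<in>insert x S. card (?F a))"
    using assms by (intro card_UN_disjoint) (auto intro: finite_subset[OF _ finite_involutions])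
  also have "\<dots> = card (involutions S) + (\<Sum>a\<in>S. card (?F a))"
    using assms fixing by simp
  also have "(\<Sum>a\<in>S. card (?F a)) = (\<Sum>a\<in>S. card (involutions (S - {a})))"
    using bij_betw_same_card[OF bij_betw_involutions_swapping[OF assms(2)]]
    by (intro sum.cong) auto
  finally show ?thesis .
qed

text \<open>
  The recurrence for \<open>insert\<close> expresses the count through smaller sets, so by induction it depends
  on the cardinality alone.
\<close>

lemma card_involutions:
  assumes "finite S"
  shows "card (involutions S) = num_involutions (card S)"
proof -
  have "card (involutions S) = card (involutions T)"
    if "finite S" "finite T" "card S = card T" for S :: "'a set" and T :: "nat set"
    using that
  proof (induction "card S" arbitrary: S T rule: less_induct)
    case less
    show ?case
    proof (cases "S = {}")
      case True
      then have "T = {}" using less.prems by simp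
      with True show ?thesis by (simp add: involutions_empty)
    next
      case False
      then obtain x S' where S: "S = insert x S'" "x \<notin> S'"
        using mk_disjoint_insert[of _ S] by blast
      from False less.prems have "T \<noteq> {}" by auto
      then obtain y T' where T: "T = insert y T'" "y \<notin> T'"
        using mk_disjoint_insert[of _ T] by blast
      have fin: "finite S'" "finite T'" and card: "card S' = card T'"
        using less.prems S T by auto
      have "card (involutions S') = card (involutions T')"
        using less.hyps[of S' T'] fin card S by simp
      moreover have "(\<Sum>a\<in>S'. card (involutions (S' - {a}))) =
                     (\<Sum>b\<in>T'. card (involutions (T' - {b})))"
      proof -
        obtain h where h: "bij_betw h S' T'"
          using finite_same_card_bij fin card by blast
        have "card (involutions (S' - {a})) = card (involutions (T' - {h a}))" if "a \<in> S'" for a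
        proof (rule less.hyps)
          show "card (S' - {a}) < card S"
            using S fin that by (simp add: card_Diff_singleton_if)
          show "card (S' - {a}) = card (T' - {h a})"
            using fin card that bij_betwE[OF h] by simp
        qed (use fin in auto)
        then show ?thesis
          using sum.reindex_bij_betw[OF h, of "\<lambda>b. card (involutions (T' - {b}))"] by simp
      qed
      ultimately show ?thesis
        using S T fin by (simp add: card_involutions_insert)
    qed
  qed
  from this[of S "{..<card S}"] assms show ?thesis
    by (simp add: num_involutions_def)
qed

lemma num_involutions_0: "num_involutions 0 = 1"
  by (simp add: num_involutions_def involutions_empty)

text \<open>For \<open>m = 0\<close> the truncated index \<open>m - 1\<close> is harmless: its factor \<open>m\<close> vanishes.\<close>

lemma num_involutions_Suc:
  "num_involutions (Suc m) = num_involutions m + m * num_involutions (m - 1)"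
  using card_involutions_insert[of "{..<m}" m]
  by (simp add: card_involutions lessThan_Suc)

definition involution_egf :: "rat fps" where
  "involution_egf = Abs_fps (\<lambda>m. of_nat (num_involutions m) / fact m)"

text \<open>The series \<open>Y (- X)\<close>, given by its coefficients.\<close>

definition reflected_involution_egf :: "rat fps" where
  "reflected_involution_egf = Abs_fps (\<lambda>m. (- 1) ^ m * of_nat (num_involutions m) / fact m)"

lemma fps_deriv_involution_egf:
  "fps_deriv involution_egf = (1 + fps_X) * involution_egf"
proof (rule fps_ext)
  show "fps_deriv involution_egf $ m = ((1 + fps_X) * involution_egf) $ m" for m
    by (cases m)
       (auto simp: involution_egf_def num_involutions_Suc distrib_right
         divide_simps simp del: of_nat_Suc, simp add: algebra_simps)
qed

lemma fps_deriv_reflected_involution_egf: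
  "fps_deriv reflected_involution_egf = (fps_X - 1) * reflected_involution_egf"
proof (rule fps_ext)
  show "fps_deriv reflected_involution_egf $ m = ((fps_X - 1) * reflected_involution_egf) $ m" for m
    by (cases m)
       (auto simp: reflected_involution_egf_def num_involutions_Suc left_diff_distrib
         divide_simps simp del: of_nat_Suc, simp add: algebra_simps)
qed

text \<open>
  A solution of \<open>P' = 2 * X * P\<close> is a multiple of \<open>exp (X^2)\<close>: the equation relates coefficients
  whose indices differ by two.
\<close>

lemma fps_nth_even_of_deriv_eq:
  fixes P :: "'a :: field_char_0 fps"
  assumes "fps_deriv P = 2 * fps_X * P"
  shows "P $ (2 * n) = P $ 0 / fact n"
proof (induction n)
  case (Suc n)
  have "of_nat (2 * n + 2) * P $ (2 * n + 2) = fps_deriv P $ (2 * n + 1)"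
    by simp
  also have "\<dots> = 2 * P $ (2 * n)"
    by (simp add: assms numeral_fps_const mult.assoc)
  finally have "2 * (of_nat (Suc n) * P $ (2 * Suc n)) = 2 * P $ (2 * n)"
    by (simp add: algebra_simps)
  then have "of_nat (Suc n) * P $ (2 * Suc n) = P $ (2 * n)"
    unfolding mult_cancel_left by simp
  then show ?case
    using Suc by (simp add: field_simps del: of_nat_Suc)
qed simp

lemma involution_egf_product_nth:
  "(reflected_involution_egf * involution_egf) $ (2 * n) = 1 / fact n"
proof -
  let ?P = "reflected_involution_egf * involution_egf"
  have "fps_deriv ?P = 2 * fps_X * ?P"
    by (simp add: fps_deriv_involution_egf fps_deriv_reflected_involution_egf algebra_simps)
  then have "?P $ (2 * n) = ?P $ 0 / fact n"
    by (rule fps_nth_even_of_deriv_eq)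
  then show ?thesis
    by (simp add: involution_egf_def reflected_involution_egf_def num_involutions_0)
qed

theorem proposition1:
  fixes n :: nat
  assumes "n \<ge> 1"
  shows "int (((2 * n) choose n) * fact n) =
    (\<Sum>r = 0..2 * n. int ((2 * n) choose r) * (-1) ^ r
        * int (num_involutions r) * int (num_involutions (2 * n - r)))"
    (is "?lhs = ?rhs")
proof -
  have "rat_of_int ?rhs = (\<Sum>r = 0..2 * n. fact (2 * n) *
          (reflected_involution_egf $ r * involution_egf $ (2 * n - r)))"
    unfolding of_int_sum
    by (intro sum.cong)
       (auto simp: reflected_involution_egf_def involution_egf_def binomial_fact field_simps)
  also have "\<dots> = fact (2 * n) * (reflected_involution_egf * involution_egf) $ (2 * n)"
    by (simp add: fps_mult_nth sum_distrib_left)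
  also have "\<dots> = rat_of_int ?lhs"
    unfolding involution_egf_product_nth by (simp add: binomial_fact)
  finally show ?thesis
    by (simp only: of_int_eq_iff)
qed

end
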